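(* Let $\mathcal F$ be the class of all finite groups of exponent at most $2$. Then $\mathcal F(G)$ is closed in $G$ for every profinite group $G$.
   Context: For a profinite group $G$, $\mu$ is the normalized Haar measure of $G$, and $\langle X\rangle$ denotes the closed subgroup generated by $X\subseteq G$. A profinite group is pro-$\mathcal F$ if it is an inverse limit of groups in $\mathcal F$ (equivalently, all its quotients by open normal subgroups are in $\mathcal F$). For $x\in G$, $\mathcal F_G(x)=\{g\in G : \langle g,x\rangle \text{ is a pro-}\mathcal F\text{ group}\}$ (a closed subset of $G$), and $\mathcal F(G)=\{g\in G : \mu(\mathcal F_G(g))>0\}$. *)

theory Defs
  imports "HOL-Algebra.Coset" "HOL-Probability.Probability_Measure"
begin

locale topological_group = group G for G (structure) +
  fixes T :: "'a topology"
  assumes topspace_eq: "topspace T = carrier G"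
    and continuous_mult: "continuous_map (prod_topology T T) T (\<lambda>(x, y). x \<otimes> y)"
    and continuous_inv: "continuous_map T T (\<lambda>x. inv x)"

locale profinite_group = topological_group +
  assumes compact: "compact_space T"
    and Hausdorff: "Hausdorff_space T"
    and totally_disconnected: "\<And>C. connectedin T C \<Longrightarrow> \<exists>x. C \<subseteq> {x}"

text \<open>Regularity is part of the definition, since \<^term>\<open>T\<close> need not be metrizable. Compact and
  closed sets coincide in a profinite group.\<close>

definition normalized_haar_measure ::
  "('a, 'b) monoid_scheme \<Rightarrow> 'a topology \<Rightarrow> 'a measure \<Rightarrow> bool" where
  "normalized_haar_measure G T M \<longleftrightarrow>
     space M = topspace T \<and>
     sets M = sigma_sets (topspace T) {U. openin T U} \<and>
     prob_space M \<and>
     (\<forall>g\<in>carrier G. \<forall>A\<in>sets M. emeasure M (g <#\<^bsub>G\<^esub> A) = emeasure M A) \<and>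
     (\<forall>A\<in>sets M. emeasure M A = (INF U\<in>{U. openin T U \<and> A \<subseteq> U}. emeasure M U)) \<and>
     (\<forall>U. openin T U \<longrightarrow> emeasure M U = (SUP K\<in>{K. compactin T K \<and> K \<subseteq> U}. emeasure M K))"

definition closed_subgroup_generated ::
  "('a, 'b) monoid_scheme \<Rightarrow> 'a topology \<Rightarrow> 'a set \<Rightarrow> 'a set" where
  "closed_subgroup_generated G T X = (\<lambda>H. subgroup H G \<and> closedin T H) hull X"

text \<open>A class of groups is a predicate; here it is applied to quotients of \<^term>\<open>G\<close>, whose
  elements are cosets.\<close>

definition pro_class ::
  "('a set monoid \<Rightarrow> bool) \<Rightarrow> ('a, 'b) monoid_scheme \<Rightarrow> 'a topology \<Rightarrow> bool" where
  "pro_class \<F> G T \<longleftrightarrow>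
     profinite_group G T \<and> (\<forall>N. N \<lhd> G \<and> openin T N \<longrightarrow> \<F> (G Mod N))"

definition class_set_at ::
  "('a set monoid \<Rightarrow> bool) \<Rightarrow> ('a, 'b) monoid_scheme \<Rightarrow> 'a topology \<Rightarrow> 'a \<Rightarrow> 'a set" where
  "class_set_at \<F> G T x =
     {g \<in> carrier G.
        let H = closed_subgroup_generated G T {g, x}
        in pro_class \<F> (G\<lparr>carrier := H\<rparr>) (subtopology T H)}"

definition class_set ::
  "('a set monoid \<Rightarrow> bool) \<Rightarrow> ('a, 'b) monoid_scheme \<Rightarrow> 'a topology \<Rightarrow> 'a measure \<Rightarrow> 'a set" where
  "class_set \<F> G T M = {g \<in> carrier G. measure M (class_set_at \<F> G T g) > 0}"

definition group_exponent :: "('a, 'b) monoid_scheme \<Rightarrow> nat" where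
  "group_exponent G = (LEAST n. n > 0 \<and> (\<forall>x\<in>carrier G. x [^]\<^bsub>G\<^esub> n = \<one>\<^bsub>G\<^esub>))"

text \<open>Every finite group has a positive exponent, so the \<open>LEAST\<close> above is attained.\<close>

definition finite_exponent_at_most_2 :: "('a, 'b) monoid_scheme \<Rightarrow> bool" where
  "finite_exponent_at_most_2 G \<longleftrightarrow> group G \<and> finite (carrier G) \<and> group_exponent G \<le> 2"

end

theory Submission
  imports Defs "HOL-Algebra.Multiplicative_Group"
begin

text \<open>A profinite group is pro-\<open>\<F>\<close>, for \<open>\<F>\<close> the finite groups of exponent at most \<open>2\<close>, exactly
  when all its elements square to the identity: a nontrivial square would survive in some finite
  quotient. Such a group is abelian, so \<open>\<F>\<^sub>G(x)\<close> is empty unless \<open>x\<^sup>2 = 1\<close>, and then it is the set of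
  all \<open>g\<close> with \<open>g\<^sup>2 = 1\<close> and \<open>gx = xg\<close> (\<open>class_set_at_exponent_2_eq\<close>).

  If \<open>\<F>(G)\<close> is not empty, the solutions of \<open>g\<^sup>2 = 1\<close> therefore have positive measure. They then fill
  more than three quarters of some coset \<open>tN\<close> of an open subgroup, where \<open>t\<^sup>2 = 1\<close>. So for most \<open>n\<close>
  in \<open>N\<close> conjugation by \<open>t\<close> inverts \<open>n\<close>. Two elements \<open>n\<close> and \<open>m\<close> that are inverted together with their
  product commute, and a subgroup of more than half the measure of \<open>N\<close> is \<open>N\<close>; hence \<open>N\<close> is abelian
  (\<open>open_abelian_subgroup_of_many_involutions\<close>).

  Let \<open>A\<close> be an open abelian subgroup. If \<open>s\<close> lies in \<open>\<F>\<^sub>G(x)\<close>, then \<open>\<F>\<^sub>G(x) \<inter> sA\<close> is a translate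
  of the set of those \<open>b\<close> in \<open>A\<close> that commute with \<open>x\<close> and satisfy \<open>(sb)\<^sup>2 = 1\<close>. Since \<open>A\<close> is abelian,
  that set is the same for all such pairs of \<open>x\<close> and \<open>s\<close> with given cosets \<open>xA\<close> and \<open>sA\<close>
  (\<open>measure_commuting_involutions_l_coset\<close>). Consequently \<open>\<F>(G)\<close> is a union, over some of the
  finitely many pairs \<open>(D, E)\<close> of cosets of \<open>A\<close>, of the sets of all \<open>x\<close> in \<open>D\<close> for which \<open>\<F>\<^sub>G(x)\<close> meets
  \<open>E\<close>. Each of these is a projection of a compact set, hence closed.\<close>

section \<open>Cosets and open subgroups of a profinite group\<close>

context topological_group
begin

lemma continuous_map_mult:
  assumes "continuous_map X T f" "continuous_map X T g"
  shows "continuous_map X T (\<lambda>x. f x \<otimes> g x)"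
  using continuous_map_compose[OF continuous_map_pairedI[OF assms] continuous_mult]
  by (simp add: o_def)

lemma continuous_map_inverse:
  assumes "continuous_map X T f"
  shows "continuous_map X T (\<lambda>x. inv f x)"
  using continuous_map_compose[OF assms continuous_inv] by (simp add: o_def)

lemma continuous_map_const_carrier:
  assumes "g \<in> carrier G"
  shows "continuous_map X T (\<lambda>x. g)"
  using assms by (simp add: topspace_eq)

lemma l_coset_eq_preimage:
  assumes "g \<in> carrier G" "U \<subseteq> carrier G"
  shows "g <#\<^bsub>G\<^esub> U = {x \<in> topspace T. inv g \<otimes> x \<in> U}"
proof -
  have "x \<in> g <#\<^bsub>G\<^esub> U \<longleftrightarrow> inv g \<otimes> x \<in> U" if "x \<in> carrier G" for x
    using that assms by (force simp: l_coset_def m_assoc[symmetric])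
  then show ?thesis
    using l_coset_subset_G[OF assms(2,1)] topspace_eq by blast
qed

lemma openin_l_coset:
  assumes "openin T U" "g \<in> carrier G"
  shows "openin T (g <#\<^bsub>G\<^esub> U)"
proof -
  have "U \<subseteq> carrier G" using openin_subset[OF assms(1)] topspace_eq by simp
  moreover have "continuous_map T T (\<lambda>x. inv g \<otimes> x)"
    by (intro continuous_map_mult continuous_map_const_carrier continuous_map_id[unfolded id_def]
      inv_closed assms)
  ultimately show ?thesis
    using openin_continuous_map_preimage[OF _ assms(1)] l_coset_eq_preimage[OF assms(2)] by simp
qed

lemma closedin_l_coset:
  assumes "closedin T U" "g \<in> carrier G"
  shows "closedin T (g <#\<^bsub>G\<^esub> U)"
proof -
  have "U \<subseteq> carrier G" using closedin_subset[OF assms(1)] topspace_eq by simp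
  moreover have "continuous_map T T (\<lambda>x. inv g \<otimes> x)"
    by (intro continuous_map_mult continuous_map_const_carrier continuous_map_id[unfolded id_def]
      inv_closed assms)
  ultimately show ?thesis
    using closedin_continuous_map_preimage[OF _ assms(1)] l_coset_eq_preimage[OF assms(2)] by simp
qed

lemma l_coset_self:
  assumes "subgroup H G" "g \<in> carrier G"
  shows "g \<in> g <#\<^bsub>G\<^esub> H"
  using assms subgroup.one_closed[OF assms(1)] unfolding l_coset_def by force

lemma l_cosets_partition:
  assumes "subgroup H G" "x \<in> carrier G" "y \<in> carrier G" "z \<in> x <#\<^bsub>G\<^esub> H" "z \<in> y <#\<^bsub>G\<^esub> H"
  shows "x <#\<^bsub>G\<^esub> H = y <#\<^bsub>G\<^esub> H"
  using assms l_repr_independence by metis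

text \<open>A subgroup is a union of translates of any nonempty subset of it.\<close>

lemma subgroup_openin:
  assumes H: "subgroup H G" and V: "openin T V" "\<one> \<in> V" "V \<subseteq> H"
  shows "openin T H"
proof (subst openin_subopen, intro ballI)
  fix h assume h: "h \<in> H"
  have hc: "h \<in> carrier G" using H h subgroup.mem_carrier by metis
  have "h <#\<^bsub>G\<^esub> V \<subseteq> H"
    using V(3) h H by (auto simp: l_coset_def intro: subgroup.m_closed)
  moreover have "h \<in> h <#\<^bsub>G\<^esub> V"
    using V(2) hc unfolding l_coset_def by force
  ultimately show "\<exists>S. openin T S \<and> h \<in> S \<and> S \<subseteq> H"
    using openin_l_coset[OF V(1) hc] by blast
qed

lemma open_subgroup_closedin:
  assumes H: "subgroup H G" "openin T H"
  shows "closedin T H"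
proof -
  have sub: "H \<subseteq> carrier G" using H(1) subgroup.subset by blast
  have "topspace T - H = (\<Union>g\<in>carrier G - H. g <#\<^bsub>G\<^esub> H)"
  proof (intro equalityI subsetI)
    fix g assume "g \<in> topspace T - H"
    then show "g \<in> (\<Union>g\<in>carrier G - H. g <#\<^bsub>G\<^esub> H)"
      using l_coset_self[OF H(1)] topspace_eq by auto
  next
    fix z assume "z \<in> (\<Union>g\<in>carrier G - H. g <#\<^bsub>G\<^esub> H)"
    then obtain g where g: "g \<in> carrier G" "g \<notin> H" "z \<in> g <#\<^bsub>G\<^esub> H" by blast
    have "z \<notin> H"
    proof
      assume "z \<in> H"
      then have "z \<in> \<one> <#\<^bsub>G\<^esub> H" using lcos_mult_one[OF sub] by simp
      then have "g <#\<^bsub>G\<^esub> H = \<one> <#\<^bsub>G\<^esub> H" using l_cosets_partition[OF H(1) g(1) one_closed g(3)] by blast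
      then show False
        using l_coset_self[OF H(1) g(1)] g(2) lcos_mult_one[OF sub] by simp
    qed
    moreover have "z \<in> topspace T"
      using g l_coset_subset_G[OF sub g(1)] topspace_eq by blast
    ultimately show "z \<in> topspace T - H" by blast
  qed
  then have "openin T (topspace T - H)"
    using openin_l_coset[OF H(2)] by auto
  then show ?thesis
    using sub topspace_eq by (simp add: closedin_def)
qed

end

context profinite_group
begin

text \<open>The cosets form an open cover without proper subcovers.\<close>

lemma finite_l_cosets:
  assumes H: "subgroup H G" "openin T H"
  shows "finite ((\<lambda>g. g <#\<^bsub>G\<^esub> H) ` carrier G)"
proof -
  let ?C = "(\<lambda>g. g <#\<^bsub>G\<^esub> H) ` carrier G"
  have op: "\<And>D. D \<in> ?C \<Longrightarrow> openin T D" using openin_l_coset[OF H(2)] by auto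
  have cov: "topspace T \<subseteq> \<Union>?C" using l_coset_self[OF H(1)] topspace_eq by auto
  obtain F where F: "finite F" "F \<subseteq> ?C" "topspace T \<subseteq> \<Union>F"
    using compact[unfolded compact_space_alt] op cov by meson
  have "?C \<subseteq> F"
  proof
    fix D assume "D \<in> ?C"
    then obtain g where g: "g \<in> carrier G" "D = g <#\<^bsub>G\<^esub> H" by blast
    then obtain E where E: "E \<in> F" "g \<in> E" using F(3) topspace_eq by blast
    then obtain k where k: "k \<in> carrier G" "E = k <#\<^bsub>G\<^esub> H" using F(2) by blast
    have "D = E"
      using l_cosets_partition[OF H(1) g(1) k(1) l_coset_self[OF H(1) g(1)]] E g k by simp
    then show "D \<in> F" using E by simp
  qed
  then show ?thesis using F(1) finite_subset by blast
qed

text \<open>This is the tube lemma for the preimage of \<open>U\<close> under multiplication, around \<open>K \<times> {\<one>}\<close>.\<close>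

lemma right_neighbourhood_of_compact:
  assumes K: "compactin T K" and U: "openin T U" "K \<subseteq> U"
  obtains V where "openin T V" "\<one> \<in> V" "\<And>k v. k \<in> K \<Longrightarrow> v \<in> V \<Longrightarrow> k \<otimes> v \<in> U"
proof -
  let ?W = "{p \<in> topspace (prod_topology T T). (case p of (x, y) \<Rightarrow> x \<otimes> y) \<in> U}"
  have W: "openin (prod_topology T T) ?W"
    by (rule openin_continuous_map_preimage[OF continuous_mult U(1)])
  have Kc: "K \<subseteq> carrier G" using compactin_subset_topspace[OF K] topspace_eq by simp
  then have "K \<times> {\<one>} \<subseteq> ?W" using U(2) by (auto simp: topspace_eq subset_iff)
  then obtain A V where "openin T A" "openin T V" "K \<subseteq> A" "\<one> \<in> V" "A \<times> V \<subseteq> ?W"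
    using tube_lemma_left[OF W K, of \<one>] by (auto simp: topspace_eq)
  moreover have "k \<otimes> v \<in> U" if "A \<times> V \<subseteq> ?W" "k \<in> A" "v \<in> V" for k v
    using subsetD[OF that(1), of "(k, v)"] that(2,3) by simp
  ultimately show ?thesis by (intro that[of V]) blast+
qed

text \<open>Total disconnectedness and compactness give a clopen \<open>K\<close> with \<open>\<one> \<in> K \<subseteq> U\<close>. Its right stabilizer
  is contained in \<open>K\<close>, because \<open>\<one> \<in> K\<close>, and it is open, because \<open>K\<close> is both compact and open.\<close>

lemma open_subgroup_in_neighbourhood:
  assumes U: "openin T U" "\<one> \<in> U"
  obtains N where "subgroup N G" "openin T N" "N \<subseteq> U"
proof -
  have "separated_between T {\<one>} (topspace T - U)"
  proof (rule cut_wire_fence_theorem[OF compact Hausdorff])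
    show "closedin T {\<one>}" using Hausdorff by (simp add: closedin_Hausdorff_sing_eq topspace_eq)
    show "closedin T (topspace T - U)" using U by blast
    show "disjnt C {\<one>} \<or> disjnt C (topspace T - U)" if "connectedin T C" for C
      using totally_disconnected[OF that] U(2) by (auto simp: disjnt_def)
  qed
  then obtain K where K: "closedin T K" "openin T K" "\<one> \<in> K" "topspace T - U \<subseteq> topspace T - K"
    by (auto simp: separated_between)
  have Kc: "K \<subseteq> carrier G" using openin_subset[OF K(2)] topspace_eq by simp
  have KU: "K \<subseteq> U" using K(4) Kc topspace_eq by blast
  obtain V where V: "openin T V" "\<one> \<in> V" "\<And>k v. k \<in> K \<Longrightarrow> v \<in> V \<Longrightarrow> k \<otimes> v \<in> K"
    using right_neighbourhood_of_compact[OF closedin_compact_space[OF compact K(1)] K(2)] by blast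
  define N where "N = {n \<in> carrier G. \<forall>k\<in>K. k \<otimes> n \<in> K \<and> k \<otimes> inv n \<in> K}"
  have N: "subgroup N G"
  proof (rule subgroup.intro)
    fix x y assume xy: "x \<in> N" "y \<in> N"
    have "k \<otimes> (x \<otimes> y) \<in> K \<and> k \<otimes> inv (x \<otimes> y) \<in> K" if "k \<in> K" for k
    proof -
      have "k \<in> carrier G" using that Kc by blast
      then have "k \<otimes> (x \<otimes> y) = (k \<otimes> x) \<otimes> y" "k \<otimes> inv (x \<otimes> y) = (k \<otimes> inv y) \<otimes> inv x"
        using xy by (simp_all add: N_def inv_mult_group m_assoc)
      then show ?thesis using xy that by (simp add: N_def)
    qed
    then show "x \<otimes> y \<in> N" using xy by (simp add: N_def)
  qed (use Kc in \<open>auto simp: N_def subset_iff\<close>)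
  let ?V = "V \<inter> {v \<in> topspace T. inv v \<in> V}"
  have "openin T ?V"
    using V(1) openin_continuous_map_preimage[OF continuous_inv V(1)] by blast
  moreover have "\<one> \<in> ?V" using V(2) by (simp add: topspace_eq)
  moreover have "?V \<subseteq> N" using V(3) by (auto simp: N_def topspace_eq)
  ultimately have "openin T N" using subgroup_openin[OF N] by blast
  moreover have "N \<subseteq> U"
  proof
    fix n assume "n \<in> N"
    then have "n \<in> carrier G" "\<one> \<otimes> n \<in> K" using K(3) by (auto simp: N_def)
    then show "n \<in> U" using KU by auto
  qed
  ultimately show ?thesis using N that by blast
qed

text \<open>The normal core of an open subgroup is open: by the tube lemma, all conjugates of the
  elements of some neighbourhood of \<open>\<one>\<close> stay in the subgroup.\<close>

lemma open_normal_subgroup_in_neighbourhood: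
  assumes U: "openin T U" "\<one> \<in> U"
  obtains N where "N \<lhd> G" "openin T N" "N \<subseteq> U"
proof -
  obtain H where H: "subgroup H G" "openin T H" "H \<subseteq> U"
    using open_subgroup_in_neighbourhood[OF U] by blast
  define N where "N = {n \<in> carrier G. \<forall>g\<in>carrier G. g \<otimes> n \<otimes> inv g \<in> H}"
  have N: "subgroup N G"
  proof (rule subgroup.intro)
    fix x y assume xy: "x \<in> N" "y \<in> N"
    show "x \<otimes> y \<in> N" unfolding N_def
    proof (intro CollectI conjI ballI)
      fix g assume g: "g \<in> carrier G"
      have "(g \<otimes> x \<otimes> inv g) \<otimes> (g \<otimes> y \<otimes> inv g) \<in> H"
        using xy g H(1) by (auto simp: N_def intro: subgroup.m_closed)
      moreover have "(g \<otimes> x \<otimes> inv g) \<otimes> (g \<otimes> y \<otimes> inv g) = g \<otimes> (x \<otimes> y) \<otimes> inv g"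
        using xy g by (simp add: N_def m_assoc inv_solve_left) (simp add: m_assoc[symmetric])
      ultimately show "g \<otimes> (x \<otimes> y) \<otimes> inv g \<in> H" by simp
    qed (use xy in \<open>auto simp: N_def\<close>)
  next
    fix x assume x: "x \<in> N"
    show "inv x \<in> N" unfolding N_def
    proof (intro CollectI conjI ballI)
      fix g assume g: "g \<in> carrier G"
      have "inv (g \<otimes> x \<otimes> inv g) \<in> H"
        using x g H(1) by (auto simp: N_def intro: subgroup.m_inv_closed)
      then show "g \<otimes> inv x \<otimes> inv g \<in> H"
        using x g by (simp add: N_def inv_mult_group m_assoc)
    qed (use x in \<open>auto simp: N_def\<close>)
  qed (use H(1) in \<open>auto simp: N_def subgroup.one_closed\<close>)
  have "N \<lhd> G"
    unfolding normal_inv_iff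
  proof (intro conjI ballI N)
    fix x h assume xh: "x \<in> carrier G" "h \<in> N"
    have "g \<otimes> (x \<otimes> h \<otimes> inv x) \<otimes> inv g = (g \<otimes> x) \<otimes> h \<otimes> inv (g \<otimes> x)" if "g \<in> carrier G" for g
      using that xh by (simp add: N_def inv_mult_group m_assoc)
    then show "x \<otimes> h \<otimes> inv x \<in> N" using xh by (auto simp: N_def)
  qed
  moreover have "openin T N"
  proof -
    let ?f = "\<lambda>p. fst p \<otimes> snd p \<otimes> inv (fst p)"
    let ?W = "{p \<in> topspace (prod_topology T T). ?f p \<in> H}"
    have "continuous_map (prod_topology T T) T ?f"
      by (intro continuous_map_mult continuous_map_inverse continuous_map_fst continuous_map_snd)
    then have W: "openin (prod_topology T T) ?W"
      using openin_continuous_map_preimage H(2) by blast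
    have "topspace T \<times> {\<one>} \<subseteq> ?W"
      using H(1) by (auto simp: topspace_eq subgroup.one_closed)
    then obtain A V where "topspace T \<subseteq> A" "openin T V" "\<one> \<in> V" "A \<times> V \<subseteq> ?W"
      using tube_lemma_left[OF W, of "topspace T" \<one>] compact
      by (auto simp: topspace_eq compact_space_def)
    then have "V \<subseteq> N"
      using openin_subset[of T V] unfolding N_def by (fastforce simp: topspace_eq)
    then show ?thesis using subgroup_openin[OF N] \<open>openin T V\<close> \<open>\<one> \<in> V\<close> by blast
  qed
  moreover have "N \<subseteq> U" proof
    fix n assume "n \<in> N"
    then have "n \<in> carrier G" "\<one> \<otimes> n \<otimes> inv \<one> \<in> H"
      unfolding N_def using one_closed by blast+
    then show "n \<in> U" using H(3) by auto
  qed
  ultimately show ?thesis using that by blast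
qed

end

section \<open>Pro-exponent-2 groups\<close>

lemma square_one_of_exponent_at_most_2:
  assumes K: "finite_exponent_at_most_2 K" and x: "x \<in> carrier K"
  shows "x \<otimes>\<^bsub>K\<^esub> x = \<one>\<^bsub>K\<^esub>"
proof -
  interpret K: group K using K by (simp add: finite_exponent_at_most_2_def)
  let ?P = "\<lambda>n::nat. n > 0 \<and> (\<forall>x\<in>carrier K. x [^]\<^bsub>K\<^esub> n = \<one>\<^bsub>K\<^esub>)"
  have "?P (Coset.order K)"
    using K by (auto simp: finite_exponent_at_most_2_def K.pow_order_eq_1 K.order_gt_0_iff_finite)
  then have P: "?P (group_exponent K)"
    unfolding group_exponent_def by (rule LeastI)
  moreover have "group_exponent K \<le> 2" using K by (simp add: finite_exponent_at_most_2_def)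
  ultimately have "group_exponent K = 1 \<or> group_exponent K = 2" by auto
  then show ?thesis
    using P x by (auto simp: numeral_2_eq_2)
qed

lemma exponent_at_most_2I:
  assumes "group K" "finite (carrier K)" "\<And>x. x \<in> carrier K \<Longrightarrow> x \<otimes>\<^bsub>K\<^esub> x = \<one>\<^bsub>K\<^esub>"
  shows "finite_exponent_at_most_2 K"
proof -
  interpret K: group K by fact
  have "group_exponent K \<le> 2"
    unfolding group_exponent_def
    by (rule Least_le) (use assms(3) in \<open>simp add: numeral_2_eq_2\<close>)
  then show ?thesis using assms by (simp add: finite_exponent_at_most_2_def)
qed

text \<open>If \<open>x\<^sup>2 \<noteq> \<one>\<close>, some open normal subgroup misses \<open>x\<^sup>2\<close>, so \<open>x\<^sup>2\<close> is nontrivial in the quotient.\<close>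

lemma square_one_of_pro_exponent_2:
  assumes G: "pro_class finite_exponent_at_most_2 G T" and x: "x \<in> carrier G"
  shows "x \<otimes>\<^bsub>G\<^esub> x = \<one>\<^bsub>G\<^esub>"
proof (rule ccontr)
  assume ne: "x \<otimes>\<^bsub>G\<^esub> x \<noteq> \<one>\<^bsub>G\<^esub>"
  interpret profinite_group G T using G by (simp add: pro_class_def)
  let ?U = "topspace T - {x \<otimes>\<^bsub>G\<^esub> x}"
  have "openin T ?U"
    using Hausdorff x
    by (intro openin_diff openin_topspace) (simp add: closedin_Hausdorff_sing_eq topspace_eq)
  moreover have "\<one>\<^bsub>G\<^esub> \<in> ?U" using ne by (simp add: topspace_eq)
  ultimately obtain N where N: "N \<lhd> G" "openin T N" "N \<subseteq> ?U"
    using open_normal_subgroup_in_neighbourhood by blast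
  interpret N: normal N G by (rule N(1))
  have "finite_exponent_at_most_2 (G Mod N)" using G N by (simp add: pro_class_def)
  moreover have "N #>\<^bsub>G\<^esub> x \<in> carrier (G Mod N)" using x by (simp add: carrier_FactGroup)
  ultimately have "(N #>\<^bsub>G\<^esub> x) \<otimes>\<^bsub>G Mod N\<^esub> (N #>\<^bsub>G\<^esub> x) = \<one>\<^bsub>G Mod N\<^esub>"
    by (rule square_one_of_exponent_at_most_2)
  then have "N #>\<^bsub>G\<^esub> (x \<otimes>\<^bsub>G\<^esub> x) = N" using x by (simp add: N.rcos_sum)
  then have "x \<otimes>\<^bsub>G\<^esub> x \<in> N"
    using coset_join1[OF _ _ N.subgroup_axioms] N.subset x by simp
  then show False using N(3) by blast
qed

context profinite_group
begin

lemma profinite_closed_subgroup: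
  assumes H: "subgroup H G" "closedin T H"
  shows "profinite_group (G\<lparr>carrier := H\<rparr>) (subtopology T H)"
proof -
  interpret GH: group "G\<lparr>carrier := H\<rparr>" using H(1) by (rule subgroup_imp_group)
  have Hc: "H \<subseteq> carrier G" using H(1) subgroup.subset by blast
  show ?thesis
  proof
    show "topspace (subtopology T H) = carrier (G\<lparr>carrier := H\<rparr>)"
      using Hc by (auto simp: topspace_eq)
    have "continuous_map (subtopology (prod_topology T T) (H \<times> H)) (subtopology T H)
        (\<lambda>(x, y). x \<otimes> y)"
      using H(1) continuous_mult
      by (intro continuous_map_into_subtopology continuous_map_from_subtopology)
        (auto intro: subgroup.m_closed)
    then show "continuous_map (prod_topology (subtopology T H) (subtopology T H)) (subtopology T H)
        (\<lambda>(x, y). x \<otimes>\<^bsub>G\<lparr>carrier := H\<rparr>\<^esub> y)"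
      by (simp add: subtopology_Times)
    have "continuous_map (subtopology T H) (subtopology T H) (\<lambda>x. inv x)"
      using H(1) continuous_inv
      by (intro continuous_map_into_subtopology continuous_map_from_subtopology)
        (auto intro: subgroup.m_inv_closed)
    then show "continuous_map (subtopology T H) (subtopology T H) (\<lambda>x. inv\<^bsub>G\<lparr>carrier := H\<rparr>\<^esub> x)"
      by (rule continuous_map_eq) (use H(1) in auto)
    show "compact_space (subtopology T H)"
      using closedin_compact_space[OF compact H(2)] by (rule compact_space_subtopology)
    show "Hausdorff_space (subtopology T H)"
      using Hausdorff by (rule Hausdorff_space_subtopology)
    show "\<exists>x. C \<subseteq> {x}" if "connectedin (subtopology T H) C" for C
      using that totally_disconnected by (auto simp: connectedin_subtopology)
  qed
qed

lemma klein_subgroup: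
  assumes g: "g \<in> carrier G" "g \<otimes> g = \<one>" and x: "x \<in> carrier G" "x \<otimes> x = \<one>"
    and comm: "g \<otimes> x = x \<otimes> g"
  defines "V \<equiv> {\<one>, g, x, g \<otimes> x}"
  shows "subgroup V G" "\<And>v. v \<in> V \<Longrightarrow> v \<otimes> v = \<one>"
proof -
  have 1: "x \<otimes> g = g \<otimes> x" using comm by simp
  have 2: "g \<otimes> (g \<otimes> x) = x" "x \<otimes> (g \<otimes> x) = g" "g \<otimes> x \<otimes> g = x" "g \<otimes> x \<otimes> x = g"
  proof -
    show gx: "g \<otimes> (g \<otimes> x) = x" using g x by (simp add: m_assoc[symmetric])
    have xg: "x \<otimes> (x \<otimes> g) = g" using g x by (simp add: m_assoc[symmetric])
    then show "x \<otimes> (g \<otimes> x) = g" using comm by simp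
    show "g \<otimes> x \<otimes> g = x" using gx 1 g x by (simp add: m_assoc)
    show "g \<otimes> x \<otimes> x = g" using g x by (simp add: m_assoc)
  qed
  have 3: "g \<otimes> x \<otimes> (g \<otimes> x) = \<one>"
    using g x 2 by (simp add: m_assoc)
  show sq: "\<And>v. v \<in> V \<Longrightarrow> v \<otimes> v = \<one>"
    using g x 3 by (auto simp: V_def)
  have Vc: "V \<subseteq> carrier G" using g x by (auto simp: V_def)
  show "subgroup V G"
  proof (rule subgroup.intro)
    show "\<And>u v. u \<in> V \<Longrightarrow> v \<in> V \<Longrightarrow> u \<otimes> v \<in> V"
      using g x 1 2 3 by (auto simp: V_def)
    show "inv v \<in> V" if "v \<in> V" for v
    proof -
      have "inv v = v" using sq[OF that] Vc that by (intro inv_equality) auto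
      then show ?thesis using that by simp
    qed
  qed (use Vc in \<open>auto simp: V_def\<close>)
qed

text \<open>If \<open>g\<close> and \<open>x\<close> are commuting solutions of \<open>v\<^sup>2 = \<one>\<close>, the closed subgroup they generate is the
  finite set \<open>{\<one>, g, x, gx}\<close>. Conversely, \<open>(gx)\<^sup>2 = \<one>\<close> makes \<open>g\<close> and \<open>x\<close> commute when both square
  to \<open>\<one>\<close>.\<close>

lemma class_set_at_exponent_2_eq:
  assumes x: "x \<in> carrier G"
  shows "class_set_at finite_exponent_at_most_2 G T x =
    {g \<in> carrier G. g \<otimes> g = \<one> \<and> x \<otimes> x = \<one> \<and> g \<otimes> x = x \<otimes> g}"
proof -
  have "pro_class finite_exponent_at_most_2 (G\<lparr>carrier := H\<rparr>) (subtopology T H) \<longleftrightarrow>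
      g \<otimes> g = \<one> \<and> x \<otimes> x = \<one> \<and> g \<otimes> x = x \<otimes> g" (is "?P \<longleftrightarrow> ?Q")
    if g: "g \<in> carrier G" and H: "H = closed_subgroup_generated G T {g, x}" for g H
  proof
    assume P: ?P
    interpret H: profinite_group "G\<lparr>carrier := H\<rparr>" "subtopology T H"
      using P by (simp add: pro_class_def)
    have sq: "\<And>h. h \<in> H \<Longrightarrow> h \<otimes> h = \<one>"
      using square_one_of_pro_exponent_2[OF P] by simp
    have gx: "g \<in> H" "x \<in> H" unfolding H closed_subgroup_generated_def by (auto intro: hull_inc)
    then have "g \<otimes> x \<in> H" using H.m_closed by simp
    then have gxgx: "g \<otimes> x \<otimes> (g \<otimes> x) = \<one>" using sq by simp
    have "inv (g \<otimes> x) = g \<otimes> x" "inv g = g" "inv x = x"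
      using gxgx sq gx g x by (auto intro: inv_equality)
    then have "g \<otimes> x = x \<otimes> g" using inv_mult_group[OF g x] by simp
    then show ?Q using sq gx by simp
  next
    assume Q: ?Q
    let ?V = "{\<one>, g, x, g \<otimes> x}"
    have V: "subgroup ?V G" "\<And>v. v \<in> ?V \<Longrightarrow> v \<otimes> v = \<one>"
      using klein_subgroup[of g x] Q g x by auto
    have clV: "closedin T ?V"
      using Hausdorff g x by (intro closedin_Hausdorff_finite) (auto simp: topspace_eq)
    have HV: "H = ?V" unfolding H closed_subgroup_generated_def
      by (rule hull_unique)
        (use V(1) clV in \<open>auto intro: subgroup.one_closed subgroup.m_closed\<close>)
    show ?P
      unfolding pro_class_def
    proof (intro conjI allI impI)
      show "profinite_group (G\<lparr>carrier := H\<rparr>) (subtopology T H)"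
        using profinite_closed_subgroup V(1) clV HV by simp
      fix N assume N: "N \<lhd> G\<lparr>carrier := H\<rparr> \<and> openin (subtopology T H) N"
      interpret N: normal N "G\<lparr>carrier := H\<rparr>" using N by blast
      show "finite_exponent_at_most_2 (G\<lparr>carrier := H\<rparr> Mod N)"
      proof (rule exponent_at_most_2I)
        show "group (G\<lparr>carrier := H\<rparr> Mod N)" by (rule N.factorgroup_is_group)
        show "finite (carrier (G\<lparr>carrier := H\<rparr> Mod N))"
          by (simp add: carrier_FactGroup HV)
        fix C assume "C \<in> carrier (G\<lparr>carrier := H\<rparr> Mod N)"
        then obtain h where h: "h \<in> H" "C = N #>\<^bsub>G\<lparr>carrier := H\<rparr>\<^esub> h"
          unfolding carrier_FactGroup by auto
        have "C <#>\<^bsub>G\<lparr>carrier := H\<rparr>\<^esub> C = N #>\<^bsub>G\<lparr>carrier := H\<rparr>\<^esub> (h \<otimes> h)"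
          using N.rcos_sum[of h h] h by simp
        also have "\<dots> = N"
          using V(2) h(1) HV N.coset_mult_one[OF N.subset] by simp
        finally show "C \<otimes>\<^bsub>G\<lparr>carrier := H\<rparr> Mod N\<^esub> C = \<one>\<^bsub>G\<lparr>carrier := H\<rparr> Mod N\<^esub>" by simp
      qed
    qed
  qed
  then show ?thesis by (auto simp: class_set_at_def Let_def)
qed

end

section \<open>Haar measure and involutions\<close>

locale haar_profinite_group = profinite_group +
  fixes M :: "'a measure"
  assumes haar: "normalized_haar_measure G T M"

sublocale haar_profinite_group \<subseteq> prob_space M
  using haar by (simp add: normalized_haar_measure_def)

lemma (in group) subgroup_commuting_with:
  assumes N: "subgroup N G" and n: "n \<in> carrier G"
  shows "subgroup {m \<in> N. n \<otimes> m = m \<otimes> n} G"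
proof -
  have Nc: "\<And>m. m \<in> N \<Longrightarrow> m \<in> carrier G" using N subgroup.mem_carrier by metis
  show ?thesis
  proof (rule subgroup.intro)
    fix a b assume ab: "a \<in> {m \<in> N. n \<otimes> m = m \<otimes> n}" "b \<in> {m \<in> N. n \<otimes> m = m \<otimes> n}"
    then have "n \<otimes> (a \<otimes> b) = (a \<otimes> n) \<otimes> b" using n Nc by (simp add: m_assoc[symmetric])
    also have "\<dots> = (a \<otimes> b) \<otimes> n" using ab n Nc by (simp add: m_assoc)
    finally show "a \<otimes> b \<in> {m \<in> N. n \<otimes> m = m \<otimes> n}"
      using ab N by (simp add: subgroup.m_closed)
  next
    fix a assume a: "a \<in> {m \<in> N. n \<otimes> m = m \<otimes> n}"
    then have ac: "a \<in> carrier G" using Nc by simp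
    have "inv a \<otimes> n = inv a \<otimes> (n \<otimes> a) \<otimes> inv a" using n ac by (simp add: m_assoc)
    also have "\<dots> = inv a \<otimes> (a \<otimes> n) \<otimes> inv a" using a by simp
    also have "\<dots> = n \<otimes> inv a" using n ac by (simp add: m_assoc[symmetric])
    finally have "n \<otimes> inv a = inv a \<otimes> n" by simp
    then show "inv a \<in> {m \<in> N. n \<otimes> m = m \<otimes> n}"
      using a N by (simp add: subgroup.m_inv_closed)
  qed (use n N Nc in \<open>auto simp: subgroup.one_closed\<close>)
qed

context haar_profinite_group
begin

lemma openin_sets: "openin T U \<Longrightarrow> U \<in> sets M"
  using haar by (auto simp: normalized_haar_measure_def)

lemma closedin_sets:
  assumes "closedin T K"
  shows "K \<in> sets M"
proof -
  have "space M - (topspace T - K) \<in> sets M"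
    using assms by (intro sets.compl_sets openin_sets) blast
  moreover have "space M - (topspace T - K) = K"
    using haar closedin_subset[OF assms] by (auto simp: normalized_haar_measure_def)
  ultimately show ?thesis by simp
qed

lemma measure_l_coset:
  assumes "g \<in> carrier G" "A \<in> sets M"
  shows "measure M (g <#\<^bsub>G\<^esub> A) = measure M A"
  using haar assms by (simp add: normalized_haar_measure_def measure_def)

text \<open>A substitute for the Lebesgue density theorem. Outer regularity gives an open \<open>U \<supseteq> K\<close> with
  \<open>c M(U) < M(K)\<close>, and compactness gives an open subgroup \<open>N\<close> with \<open>KN \<subseteq> U\<close>. The
  cosets that make up \<open>KN\<close> are equally large, so in at least one of them the proportion of \<open>K\<close> is at
  least the average, which exceeds \<open>c\<close>.\<close>

lemma compact_density_coset:
  assumes K: "closedin T K" "measure M K > 0" and c: "0 < c" "c < (1::real)"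
  obtains N k where "subgroup N G" "openin T N" "k \<in> K"
    "measure M (K \<inter> (k <#\<^bsub>G\<^esub> N)) > c * measure M N"
proof -
  have KM: "K \<in> sets M" by (rule closedin_sets[OF K(1)])
  have Kc: "K \<subseteq> carrier G" using closedin_subset[OF K(1)] topspace_eq by simp
  have "measure M K < measure M K / c"
    using K(2) c by (simp add: field_simps)
  then have "emeasure M K < ennreal (measure M K / c)"
    using K(2) c by (simp add: emeasure_eq_measure ennreal_less_iff)
  moreover have "emeasure M K = (INF U\<in>{U. openin T U \<and> K \<subseteq> U}. emeasure M U)"
    using haar KM by (simp add: normalized_haar_measure_def)
  ultimately obtain U where U: "openin T U" "K \<subseteq> U" "emeasure M U < ennreal (measure M K / c)"
    by (auto simp: INF_less_iff)
  then have U3: "c * measure M U < measure M K"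
    using c by (simp add: emeasure_eq_measure ennreal_less_iff field_simps)
  obtain V where V: "openin T V" "\<one> \<in> V" "\<And>k v. k \<in> K \<Longrightarrow> v \<in> V \<Longrightarrow> k \<otimes> v \<in> U"
    using right_neighbourhood_of_compact[OF closedin_compact_space[OF compact K(1)] U(1,2)] by blast
  obtain N where N: "subgroup N G" "openin T N" "N \<subseteq> V"
    using open_subgroup_in_neighbourhood[OF V(1,2)] by blast
  define \<C> where "\<C> = (\<lambda>k. k <#\<^bsub>G\<^esub> N) ` K"
  have fin: "finite \<C>"
    using finite_l_cosets[OF N(1,2)] Kc unfolding \<C>_def by (meson finite_subset image_mono)
  have disj: "disjoint_family_on (\<lambda>D. D) \<C>"
    unfolding disjoint_family_on_def
  proof (intro ballI impI)
    fix D E assume "D \<in> \<C>" "E \<in> \<C>" "D \<noteq> E"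
    then show "D \<inter> E = {}"
      using l_cosets_partition[OF N(1)] Kc unfolding \<C>_def by blast
  qed
  have sets: "\<And>D. D \<in> \<C> \<Longrightarrow> D \<in> sets M"
    using openin_sets openin_l_coset[OF N(2)] Kc unfolding \<C>_def by blast
  have size: "\<And>D. D \<in> \<C> \<Longrightarrow> measure M D = measure M N"
    using measure_l_coset openin_sets[OF N(2)] Kc unfolding \<C>_def by blast
  have sub: "\<Union>\<C> \<subseteq> U"
    using V(3) N(3) by (auto simp: \<C>_def l_coset_def)
  have "real (card \<C>) * measure M N = (\<Sum>D\<in>\<C>. measure M D)"
    using size by simp
  also have "\<dots> = measure M (\<Union>D\<in>\<C>. D)"
    by (rule finite_measure_finite_Union[OF fin _ disj, symmetric]) (use sets in auto)
  also have "\<dots> \<le> measure M U"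
    using sub openin_sets[OF U(1)] by (intro finite_measure_mono) auto
  finally have le: "real (card \<C>) * measure M N \<le> measure M U" .
  have "K = (\<Union>D\<in>\<C>. K \<inter> D)"
    using l_coset_self[OF N(1)] Kc by (auto simp: \<C>_def)
  then have "measure M K = (\<Sum>D\<in>\<C>. measure M (K \<inter> D))"
    using finite_measure_finite_Union[OF fin, of "\<lambda>D. K \<inter> D"] disj sets KM
    by (auto simp: disjoint_family_on_def image_subset_iff)
  have "\<exists>D\<in>\<C>. measure M (K \<inter> D) > c * measure M N"
  proof (rule ccontr)
    assume "\<not> ?thesis"
    then have "(\<Sum>D\<in>\<C>. measure M (K \<inter> D)) \<le> real (card \<C>) * (c * measure M N)"
      by (intro sum_bounded_above) auto
    also have "\<dots> \<le> c * measure M U"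
      using mult_left_mono[OF le, of c] c by (simp add: mult_ac)
    finally show False using U3 \<open>measure M K = (\<Sum>D\<in>\<C>. measure M (K \<inter> D))\<close> by simp
  qed
  then show ?thesis using that N(1,2) by (auto simp: \<C>_def)
qed

text \<open>A proper subgroup \<open>H\<close> of \<open>N\<close> has a second coset in \<open>N\<close>, disjoint from \<open>H\<close> and of equal measure.\<close>

lemma subgroup_eq_of_measure_gt_half:
  assumes H: "subgroup H G" "H \<in> sets M" and N: "subgroup N G" "N \<in> sets M"
    and sub: "H \<subseteq> N" and half: "measure M H > measure M N / 2"
  shows "H = N"
proof (rule ccontr)
  assume "H \<noteq> N"
  then obtain y where y: "y \<in> N" "y \<notin> H" using sub by blast
  have yc: "y \<in> carrier G" using y N(1) subgroup.mem_carrier by metis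
  have Hc: "H \<subseteq> carrier G" using H(1) subgroup.subset by blast
  have yH: "y <#\<^bsub>G\<^esub> H \<in> sets M"
  proof -
    have "measure M (y <#\<^bsub>G\<^esub> H) = measure M H" by (rule measure_l_coset[OF yc H(2)])
    moreover have "measure M H > 0" using half measure_nonneg[of M N] by linarith
    ultimately show ?thesis using measure_notin_sets by force
  qed
  have "z \<notin> H" if "z \<in> y <#\<^bsub>G\<^esub> H" for z
  proof
    assume "z \<in> H"
    then have "z \<in> \<one> <#\<^bsub>G\<^esub> H" using lcos_mult_one[OF Hc] by simp
    then have "y <#\<^bsub>G\<^esub> H = H"
      using l_cosets_partition[OF H(1) yc one_closed that] lcos_mult_one[OF Hc] by simp
    then show False using l_coset_self[OF H(1) yc] y(2) by simp
  qed
  then have "measure M (H \<union> (y <#\<^bsub>G\<^esub> H)) = measure M H + measure M (y <#\<^bsub>G\<^esub> H)"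
    by (intro finite_measure_Union H yH) blast
  moreover have "H \<union> (y <#\<^bsub>G\<^esub> H) \<subseteq> N"
    using sub y N(1) by (auto simp: l_coset_def intro: subgroup.m_closed)
  then have "measure M (H \<union> (y <#\<^bsub>G\<^esub> H)) \<le> measure M N"
    by (rule finite_measure_mono[OF _ N(2)])
  ultimately show False using half measure_l_coset[OF yc H(2)] by simp
qed

lemma closedin_equalizer:
  assumes "continuous_map T T f" "continuous_map T T g"
  shows "closedin T {x \<in> carrier G. f x = g x}"
  using closedin_continuous_maps_eq[OF Hausdorff assms] by (simp add: topspace_eq)

lemma closedin_involutions: "closedin T {x \<in> carrier G. x \<otimes> x = \<one>}"
  by (intro closedin_equalizer continuous_map_mult continuous_map_id[unfolded id_def]
      continuous_map_const_carrier one_closed)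

lemma closedin_commuting_with:
  assumes "n \<in> carrier G"
  shows "closedin T {x \<in> carrier G. n \<otimes> x = x \<otimes> n}"
  by (intro closedin_equalizer continuous_map_mult continuous_map_id[unfolded id_def]
      continuous_map_const_carrier assms)

text \<open>The elements of \<open>N\<close> that commute with \<open>n\<close> form a subgroup, so commuting with more than half of
  \<open>N\<close> means commuting with all of it.\<close>

lemma commutes_with_open_subgroup:
  assumes N: "subgroup N G" "openin T N" and n: "n \<in> carrier G"
    and D: "D \<subseteq> {m \<in> N. n \<otimes> m = m \<otimes> n}" "measure M D > measure M N / 2"
    and m: "m \<in> N"
  shows "n \<otimes> m = m \<otimes> n"
proof -
  let ?Z = "{m \<in> N. n \<otimes> m = m \<otimes> n}"
  have NM: "N \<in> sets M" by (rule openin_sets[OF N(2)])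
  have "?Z = N \<inter> {x \<in> carrier G. n \<otimes> x = x \<otimes> n}"
    using subgroup.subset[OF N(1)] by auto
  then have ZM: "?Z \<in> sets M"
    using NM closedin_sets[OF closedin_commuting_with[OF n]] by simp
  have "measure M ?Z > measure M N / 2"
    using finite_measure_mono[OF D(1) ZM] D(2) by linarith
  then have "?Z = N"
    by (intro subgroup_eq_of_measure_gt_half subgroup_commuting_with N(1) n ZM NM) auto
  then show ?thesis using m by blast
qed

text \<open>Take a coset \<open>tN\<close> with \<open>t\<^sup>2 = \<one>\<close> in which more than three quarters of the elements square to
  \<open>\<one>\<close>, and let \<open>S\<close> be the set of the corresponding \<open>n\<close> in \<open>N\<close>, which are those with \<open>tnt = n\<inverse>\<close>.
  For \<open>n\<close> in \<open>S\<close>, more than half of all \<open>m\<close> in \<open>N\<close> satisfy \<open>m \<in> S\<close> and \<open>nm \<in> S\<close>, and then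
  \<open>(nm)\<inverse> = tnt tmt = n\<inverse> m\<inverse> = (mn)\<inverse>\<close>. Hence \<open>S\<close> centralizes \<open>N\<close>. So every element of \<open>N\<close>
  commutes with all of \<open>S\<close>, which is more than half of \<open>N\<close>, and therefore with \<open>N\<close>.\<close>

lemma open_abelian_subgroup_of_many_involutions:
  assumes pos: "measure M {x \<in> carrier G. x \<otimes> x = \<one>} > 0"
  obtains A where "subgroup A G" "openin T A" "\<And>a b. a \<in> A \<Longrightarrow> b \<in> A \<Longrightarrow> a \<otimes> b = b \<otimes> a"
proof -
  define I where "I = {x \<in> carrier G. x \<otimes> x = \<one>}"
  have I: "closedin T I" using closedin_involutions by (simp add: I_def)
  obtain N t where N: "subgroup N G" "openin T N" and t: "t \<in> I"
    and dens: "measure M (I \<inter> (t <#\<^bsub>G\<^esub> N)) > 3/4 * measure M N"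
    using compact_density_coset[OF I, of "3/4"] pos by (auto simp: I_def)
  have tc: "t \<in> carrier G" and tt: "t \<otimes> t = \<one>" using t by (auto simp: I_def)
  have NM: "N \<in> sets M" by (rule openin_sets[OF N(2)])
  have Nc: "\<And>m. m \<in> N \<Longrightarrow> m \<in> carrier G" using N(1) subgroup.mem_carrier by metis
  define S where "S = {n \<in> N. (t \<otimes> n) \<otimes> (t \<otimes> n) = \<one>}"
  have Scl: "closedin T S"
  proof -
    have "closedin T {n \<in> carrier G. (t \<otimes> n) \<otimes> (t \<otimes> n) = \<one>}"
      by (intro closedin_equalizer continuous_map_mult continuous_map_id[unfolded id_def]
        continuous_map_const_carrier tc one_closed)
    then have "closedin T (N \<inter> {n \<in> carrier G. (t \<otimes> n) \<otimes> (t \<otimes> n) = \<one>})"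
      using open_subgroup_closedin[OF N] by (intro closedin_Int)
    moreover have "N \<inter> {n \<in> carrier G. (t \<otimes> n) \<otimes> (t \<otimes> n) = \<one>} = S" using Nc by (auto simp: S_def)
    ultimately show ?thesis by simp
  qed
  have SM: "S \<in> sets M" by (rule closedin_sets[OF Scl])
  have SN: "S \<subseteq> N" by (auto simp: S_def)
  have "I \<inter> (t <#\<^bsub>G\<^esub> N) = t <#\<^bsub>G\<^esub> S"
    using tc Nc by (auto simp: I_def S_def l_coset_def)
  then have S34: "measure M S > 3/4 * measure M N"
    using dens measure_l_coset[OF tc SM] by simp
  have Sinv: "t \<otimes> n \<otimes> t = inv n" if "n \<in> S" for n
    using that tc Nc by (intro inv_equality[symmetric]) (auto simp: S_def m_assoc)
  have centralizes: "n \<otimes> m = m \<otimes> n" if n: "n \<in> S" and m: "m \<in> N" for n m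
  proof -
    \<comment> \<open>The \<open>m\<close> in \<open>S\<close> with \<open>n \<otimes> m\<close> in \<open>S\<close>; for these, \<open>t\<close> inverts \<open>n\<close>, \<open>m\<close> and \<open>n \<otimes> m\<close>.\<close>
    let ?D = "S \<inter> (inv n <#\<^bsub>G\<^esub> S)"
    have nN: "n \<in> N" and nc: "n \<in> carrier G" using n SN Nc by auto
    have nS: "inv n <#\<^bsub>G\<^esub> S \<in> sets M"
      using closedin_sets closedin_l_coset[OF Scl] nc by simp
    have "?D \<subseteq> {m \<in> N. n \<otimes> m = m \<otimes> n}"
    proof
      fix m assume m: "m \<in> ?D"
      then have mN: "m \<in> N" and mc: "m \<in> carrier G" using SN Nc by auto
      obtain s where s: "s \<in> S" "m = inv n \<otimes> s" using m by (auto simp: l_coset_def)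
      have sc: "s \<in> carrier G" using s SN Nc by auto
      have "s = n \<otimes> m" using s nc sc by (simp add: m_assoc[symmetric])
      then have "inv (n \<otimes> m) = t \<otimes> (n \<otimes> m) \<otimes> t" using Sinv[OF s(1)] by simp
      also have "\<dots> = t \<otimes> n \<otimes> (t \<otimes> t) \<otimes> m \<otimes> t" using tt nc mc tc by (simp add: m_assoc)
      also have "\<dots> = (t \<otimes> n \<otimes> t) \<otimes> (t \<otimes> m \<otimes> t)" using nc mc tc by (simp add: m_assoc)
      also have "\<dots> = inv n \<otimes> inv m" using Sinv n m by simp
      also have "\<dots> = inv (m \<otimes> n)" using nc mc by (simp add: inv_mult_group)
      finally have "n \<otimes> m = m \<otimes> n" using nc mc inv_inv m_closed by metis
      then show "m \<in> {m \<in> N. n \<otimes> m = m \<otimes> n}" using mN by simp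
    qed
    moreover have "measure M ?D > measure M N / 2"
    proof -
      have "measure M (S \<union> (inv n <#\<^bsub>G\<^esub> S)) \<le> measure M N"
        using SN nN N(1)
        by (intro finite_measure_mono NM)
          (auto simp: l_coset_def intro!: subgroup.m_closed subgroup.m_inv_closed)
      moreover have "measure M (S \<union> (inv n <#\<^bsub>G\<^esub> S))
          = measure M S + measure M (inv n <#\<^bsub>G\<^esub> S) - measure M ?D"
        using measure_Un3[of S M "inv n <#\<^bsub>G\<^esub> S"] SM nS by (simp add: fmeasurable_eq_sets)
      moreover have "measure M (inv n <#\<^bsub>G\<^esub> S) = measure M S"
        using measure_l_coset[OF _ SM] nc by simp
      ultimately show ?thesis using S34 by linarith
    qed
    ultimately show ?thesis
      using commutes_with_open_subgroup[OF N nc] m by blast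
  qed
  have "a \<otimes> b = b \<otimes> a" if a: "a \<in> N" and b: "b \<in> N" for a b
  proof (rule commutes_with_open_subgroup[OF N Nc[OF a] _ _ b])
    show "S \<subseteq> {m \<in> N. a \<otimes> m = m \<otimes> a}" using centralizes a SN by fastforce
    show "measure M S > measure M N / 2" using S34 measure_nonneg[of M N] by linarith
  qed
  then show ?thesis using that N by blast
qed

end

section \<open>Closedness of the positive-measure locus\<close>

context group
begin

text \<open>This is \<open>\<F>\<^sub>G(x)\<close> in algebraic form; the identity counts as an involution, and the set is empty if
  \<open>x\<close> does not square to it.\<close>

definition commuting_involutions :: "'a \<Rightarrow> 'a set" where
  "commuting_involutions x = {g \<in> carrier G. g \<otimes> g = \<one> \<and> x \<otimes> x = \<one> \<and> g \<otimes> x = x \<otimes> g}"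

lemma commutes_with_l_coset_iff:
  assumes "b \<in> carrier G" "x \<in> carrier G" "a \<in> carrier G" "a \<otimes> b = b \<otimes> a"
  shows "b \<otimes> (x \<otimes> a) = (x \<otimes> a) \<otimes> b \<longleftrightarrow> b \<otimes> x = x \<otimes> b"
proof -
  have "(x \<otimes> a) \<otimes> b = x \<otimes> b \<otimes> a" using assms by (simp add: m_assoc)
  moreover have "b \<otimes> (x \<otimes> a) = b \<otimes> x \<otimes> a" using assms by (simp add: m_assoc)
  ultimately show ?thesis using assms by simp
qed

text \<open>From \<open>(sa)\<^sup>2 = \<one> = s\<^sup>2\<close> comes \<open>asa = s\<close>, so \<open>sab sab = sb (asa) b = sb sb\<close>.\<close>

lemma square_independent_of_involution_in_l_coset:
  assumes c: "s \<in> carrier G" "a \<in> carrier G" "b \<in> carrier G" and ab: "a \<otimes> b = b \<otimes> a"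
    and s: "s \<otimes> s = \<one>" "(s \<otimes> a) \<otimes> (s \<otimes> a) = \<one>"
  shows "(s \<otimes> a \<otimes> b) \<otimes> (s \<otimes> a \<otimes> b) = (s \<otimes> b) \<otimes> (s \<otimes> b)"
proof -
  have "s \<otimes> (a \<otimes> s \<otimes> a) = s \<otimes> s" using s c by (simp add: m_assoc)
  then have asa: "a \<otimes> s \<otimes> a = s" using c by simp
  have "(s \<otimes> a \<otimes> b) \<otimes> (s \<otimes> a \<otimes> b) = s \<otimes> (a \<otimes> b) \<otimes> (s \<otimes> a \<otimes> b)"
    using c by (simp add: m_assoc)
  also have "\<dots> = s \<otimes> b \<otimes> (a \<otimes> s \<otimes> a) \<otimes> b" using c unfolding ab by (simp add: m_assoc)
  finally show ?thesis using asa c by (simp add: m_assoc)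
qed

lemma commuting_involutions_Int_l_coset:
  assumes A: "subgroup A G" and x: "x \<in> carrier G" and s: "s \<in> commuting_involutions x"
  shows "commuting_involutions x \<inter> (s <#\<^bsub>G\<^esub> A) =
    s <#\<^bsub>G\<^esub> {b \<in> A. (s \<otimes> b) \<otimes> (s \<otimes> b) = \<one> \<and> b \<otimes> x = x \<otimes> b}"
proof -
  have sc: "s \<in> carrier G" "x \<otimes> x = \<one>" "s \<otimes> x = x \<otimes> s"
    using s by (auto simp: commuting_involutions_def)
  have "s \<otimes> b \<in> commuting_involutions x \<longleftrightarrow> (s \<otimes> b) \<otimes> (s \<otimes> b) = \<one> \<and> b \<otimes> x = x \<otimes> b"
    if "b \<in> A" for b
  proof -
    have b: "b \<in> carrier G" using that A subgroup.mem_carrier by metis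
    have "x \<otimes> (s \<otimes> b) = (s \<otimes> x) \<otimes> b" using sc b x by (simp add: m_assoc)
    then have "s \<otimes> b \<otimes> x = x \<otimes> (s \<otimes> b) \<longleftrightarrow> b \<otimes> x = x \<otimes> b" using sc(1) b x by (simp add: m_assoc)
    then show ?thesis using sc b by (simp add: commuting_involutions_def)
  qed
  then show ?thesis unfolding l_coset_def by auto
qed

end

context haar_profinite_group
begin

lemma closedin_commuting_involutions:
  assumes "x \<in> carrier G"
  shows "closedin T (commuting_involutions x)"
proof (cases "x \<otimes> x = \<one>")
  case True
  then have "commuting_involutions x =
      {g \<in> carrier G. g \<otimes> g = \<one>} \<inter> {g \<in> carrier G. x \<otimes> g = g \<otimes> x}"
    by (auto simp: commuting_involutions_def)
  then show ?thesis
    using closedin_Int[OF closedin_involutions closedin_commuting_with[OF assms]] by simp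
qed (simp add: commuting_involutions_def)

text \<open>Each intersection is a translate of a subset of \<open>A\<close>, by \<open>t\<close> and by \<open>s\<close> respectively. The two
  subsets coincide, because the conditions that define them do not change when \<open>x\<close> and \<open>s\<close> are
  replaced within their \<open>A\<close>-cosets, as long as \<open>s\<close> still squares to \<open>\<one>\<close>.\<close>

lemma measure_commuting_involutions_l_coset:
  assumes A: "subgroup A G" "openin T A" and abelian: "\<And>a b. a \<in> A \<Longrightarrow> b \<in> A \<Longrightarrow> a \<otimes> b = b \<otimes> a"
    and x: "x \<in> carrier G" "s \<in> commuting_involutions x"
    and y: "y \<in> x <#\<^bsub>G\<^esub> A" "t \<in> s <#\<^bsub>G\<^esub> A" "t \<in> commuting_involutions y"
  shows "measure M (commuting_involutions y \<inter> (s <#\<^bsub>G\<^esub> A))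
    = measure M (commuting_involutions x \<inter> (s <#\<^bsub>G\<^esub> A))"
proof -
  have Ac: "\<And>a. a \<in> A \<Longrightarrow> a \<in> carrier G" using A(1) subgroup.mem_carrier by metis
  have s: "s \<in> carrier G" "s \<otimes> s = \<one>" using x(2) by (auto simp: commuting_involutions_def)
  have t: "t \<in> carrier G" "t \<otimes> t = \<one>" using y(3) by (auto simp: commuting_involutions_def)
  obtain a where a: "a \<in> A" "y = x \<otimes> a" using y(1) by (auto simp: l_coset_def)
  obtain c where c: "c \<in> A" "t = s \<otimes> c" using y(2) by (auto simp: l_coset_def)
  have yc: "y \<in> carrier G" using a x Ac by simp
  let ?B = "\<lambda>s x. {b \<in> A. (s \<otimes> b) \<otimes> (s \<otimes> b) = \<one> \<and> b \<otimes> x = x \<otimes> b}"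
  have B: "?B t y = ?B s x"
  proof (intro Collect_cong conj_cong refl)
    fix b assume b: "b \<in> A"
    show "(t \<otimes> b) \<otimes> (t \<otimes> b) = \<one> \<longleftrightarrow> (s \<otimes> b) \<otimes> (s \<otimes> b) = \<one>"
      using square_independent_of_involution_in_l_coset[OF s(1), of c b] abelian[OF c(1) b] b c s t Ac
      by simp
    show "b \<otimes> y = y \<otimes> b \<longleftrightarrow> b \<otimes> x = x \<otimes> b"
      unfolding a(2) using commutes_with_l_coset_iff abelian[OF a(1) b] a b x Ac by simp
  qed
  have coset: "t <#\<^bsub>G\<^esub> A = s <#\<^bsub>G\<^esub> A"
    using l_cosets_partition[OF A(1) t(1) s(1) l_coset_self[OF A(1) t(1)] y(2)] .
  have "?B s x = A \<inter> {b \<in> carrier G. (s \<otimes> b) \<otimes> (s \<otimes> b) = \<one>} \<inter> {b \<in> carrier G. x \<otimes> b = b \<otimes> x}"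
    using Ac by auto
  moreover have "closedin T {b \<in> carrier G. (s \<otimes> b) \<otimes> (s \<otimes> b) = \<one>}"
    by (intro closedin_equalizer continuous_map_mult continuous_map_id[unfolded id_def]
        continuous_map_const_carrier s one_closed)
  ultimately have BM: "?B s x \<in> sets M"
    using openin_sets[OF A(2)] closedin_sets closedin_commuting_with[OF x(1)] by simp
  have "measure M (commuting_involutions y \<inter> (s <#\<^bsub>G\<^esub> A)) = measure M (t <#\<^bsub>G\<^esub> ?B t y)"
    using commuting_involutions_Int_l_coset[OF A(1) yc y(3)] coset by simp
  also have "\<dots> = measure M (?B s x)" unfolding B by (rule measure_l_coset[OF t(1) BM])
  also have "\<dots> = measure M (s <#\<^bsub>G\<^esub> ?B s x)" by (rule measure_l_coset[OF s(1) BM, symmetric])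
  also have "\<dots> = measure M (commuting_involutions x \<inter> (s <#\<^bsub>G\<^esub> A))"
    using commuting_involutions_Int_l_coset[OF A(1) x] by simp
  finally show ?thesis .
qed

text \<open>The set is the projection of a closed relation on \<open>D \<times> E\<close>, and projecting along a compact factor
  is a closed map.\<close>

lemma closedin_projection_of_commuting_involutions:
  assumes D: "closedin T D" and E: "closedin T E"
  shows "closedin T {x \<in> D. \<exists>s\<in>E. s \<in> commuting_involutions x}"
proof -
  let ?X = "prod_topology T T"
  let ?R = "{p \<in> topspace ?X. fst p \<otimes> fst p = \<one>} \<inter> {p \<in> topspace ?X. snd p \<otimes> snd p = \<one>} \<inter>
    {p \<in> topspace ?X. snd p \<otimes> fst p = fst p \<otimes> snd p} \<inter> D \<times> E"
  have "closedin ?X ?R"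
    by (intro closedin_Int closedin_continuous_maps_eq[OF Hausdorff] continuous_map_mult
        continuous_map_fst continuous_map_snd continuous_map_const_carrier one_closed)
      (simp add: closedin_prod_Times_iff D E)
  then have "closedin T (fst ` ?R)"
    using Abstract_Topological_Spaces.closed_map_fst[OF compact] unfolding closed_map_def by blast
  moreover have "fst ` ?R = {x \<in> D. \<exists>s\<in>E. s \<in> commuting_involutions x}"
  proof (intro equalityI subsetI)
    fix x assume "x \<in> {x \<in> D. \<exists>s\<in>E. s \<in> commuting_involutions x}"
    then obtain s where "x \<in> D" "s \<in> E" "s \<in> commuting_involutions x" by blast
    then have "(x, s) \<in> ?R"
      using closedin_subset[OF D] topspace_eq by (auto simp: commuting_involutions_def)
    then show "x \<in> fst ` ?R" by (metis (no_types, lifting) fst_conv imageI)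
  qed (auto simp: commuting_involutions_def topspace_eq)
  ultimately show ?thesis by simp
qed

text \<open>A pair of cosets \<open>(D, E)\<close> is admissible if some \<open>x\<close> in \<open>D\<close> has a positive measure of its commuting
  involutions in \<open>E\<close>. Then the same holds for each \<open>y\<close> in \<open>D\<close> with at least one commuting involution
  in \<open>E\<close>. So the set in question is the finite union, over the admissible pairs, of the closed sets
  \<open>?R\<close>.\<close>

lemma closedin_positive_measure_commuting_involutions:
  "closedin T {x \<in> carrier G. measure M (commuting_involutions x) > 0}" (is "closedin T ?F")
proof (cases "?F = {}")
  case False
  then obtain x0 where x0: "x0 \<in> carrier G" "measure M (commuting_involutions x0) > 0" by blast
  have "measure M (commuting_involutions x0) \<le> measure M {x \<in> carrier G. x \<otimes> x = \<one>}"
    by (intro finite_measure_mono closedin_sets closedin_involutions)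
      (auto simp: commuting_involutions_def)
  then obtain A where A: "subgroup A G" "openin T A"
    and abelian: "\<And>a b. a \<in> A \<Longrightarrow> b \<in> A \<Longrightarrow> a \<otimes> b = b \<otimes> a"
    using open_abelian_subgroup_of_many_involutions[OF less_le_trans[OF x0(2)]] by blast
  define \<C> where "\<C> = (\<lambda>g. g <#\<^bsub>G\<^esub> A) ` carrier G"
  have fin: "finite \<C>" using finite_l_cosets[OF A] by (simp add: \<C>_def)
  have cosets: "closedin T D" "D \<in> sets M" if "D \<in> \<C>" for D
    using that closedin_l_coset[OF open_subgroup_closedin[OF A]] closedin_sets by (auto simp: \<C>_def)
  define P where
    "P = {(D, E) \<in> \<C> \<times> \<C>. \<exists>x\<in>D. measure M (commuting_involutions x \<inter> E) > 0}"
  let ?R = "\<lambda>(D, E). {x \<in> D. \<exists>s\<in>E. s \<in> commuting_involutions x}"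
  have "?F = (\<Union>p\<in>P. ?R p)"
  proof (intro equalityI subsetI)
    fix x assume x: "x \<in> ?F"
    have eq: "commuting_involutions x = (\<Union>E\<in>\<C>. commuting_involutions x \<inter> E)"
      using l_coset_self[OF A(1)] by (auto simp: \<C>_def commuting_involutions_def)
    have "\<exists>E\<in>\<C>. measure M (commuting_involutions x \<inter> E) \<noteq> 0"
    proof (rule ccontr)
      assume "\<not> ?thesis"
      moreover have "measure M (\<Union>E\<in>\<C>. commuting_involutions x \<inter> E)
          \<le> (\<Sum>E\<in>\<C>. measure M (commuting_involutions x \<inter> E))"
        using fin cosets closedin_sets[OF closedin_commuting_involutions] x
        by (intro finite_measure_subadditive_finite) auto
      ultimately show False using x eq by simp
    qed
    then obtain E where E: "E \<in> \<C>" "measure M (commuting_involutions x \<inter> E) > 0"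
      by (metis measure_nonneg order_less_le)
    then have "commuting_involutions x \<inter> E \<noteq> {}" by force
    moreover have "x \<in> x <#\<^bsub>G\<^esub> A" using l_coset_self[OF A(1)] x by simp
    ultimately show "x \<in> (\<Union>p\<in>P. ?R p)"
      using E x by (intro UN_I[of "(x <#\<^bsub>G\<^esub> A, E)"]) (auto simp: P_def \<C>_def)
  next
    fix y assume "y \<in> (\<Union>p\<in>P. ?R p)"
    then obtain D E x t where D: "D \<in> \<C>" "E \<in> \<C>" "x \<in> D"
      and pos: "measure M (commuting_involutions x \<inter> E) > 0"
      and y: "y \<in> D" and t: "t \<in> E" "t \<in> commuting_involutions y"
      by (auto simp: P_def)
    have DG: "D \<subseteq> carrier G" using cosets(1)[OF D(1)] closedin_subset topspace_eq by blast
    have "commuting_involutions x \<inter> E \<noteq> {}" using pos by force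
    then obtain s where s: "s \<in> commuting_involutions x" "s \<in> E" by blast
    have sc: "s \<in> carrier G" using s by (simp add: commuting_involutions_def)
    have Deq: "D = x <#\<^bsub>G\<^esub> A" and Eeq: "E = s <#\<^bsub>G\<^esub> A"
      using D s sc DG l_cosets_partition[OF A(1)] l_coset_self[OF A(1)] unfolding \<C>_def by blast+
    have "measure M (commuting_involutions y \<inter> E) = measure M (commuting_involutions x \<inter> E)"
      unfolding Eeq
      by (rule measure_commuting_involutions_l_coset[OF A abelian]) (use D DG s y t Deq Eeq in auto)
    moreover have yc: "y \<in> carrier G" using y DG by blast
    moreover have "measure M (commuting_involutions y \<inter> E) \<le> measure M (commuting_involutions y)"
      using closedin_sets[OF closedin_commuting_involutions[OF yc]] by (intro finite_measure_mono) auto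
    ultimately show "y \<in> ?F" using pos by simp
  qed
  moreover have "finite P"
    using fin by (auto simp: P_def intro: finite_subset[of _ "\<C> \<times> \<C>"])
  moreover have "closedin T (?R p)" if "p \<in> P" for p
    using that cosets closedin_projection_of_commuting_involutions by (auto simp: P_def)
  ultimately show ?thesis by (auto intro!: closedin_Union)
next
  case True
  then show ?thesis by (simp only: closedin_empty)
qed

end

theorem proposition13:
  fixes G :: "('a, 'b) monoid_scheme" and T :: "'a topology" and \<mu> :: "'a measure"
  assumes "profinite_group G T"
    and "normalized_haar_measure G T \<mu>"
  shows "closedin T (class_set finite_exponent_at_most_2 G T \<mu>)"
proof -
  interpret haar_profinite_group G T \<mu>
    using assms by (simp add: haar_profinite_group_def haar_profinite_group_axioms_def)
  have "class_set finite_exponent_at_most_2 G T \<mu> =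
      {x \<in> carrier G. measure \<mu> (commuting_involutions x) > 0}"
    by (auto simp: class_set_def class_set_at_exponent_2_eq commuting_involutions_def)
  then show ?thesis using closedin_positive_measure_commuting_involutions by simp
qed

end
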